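(* Let $k\ge 3$ and $n\ge 1$ be integers, and let $G_n^{(k)}=G_n(g,f)$ be a Riordan graph such that $[z^i]g\equiv 1\pmod 2$ for each $i=0,\ldots,k-2$, $[z^1]f\equiv 1\pmod 2$, and $[z^j]f\equiv 0\pmod 2$ for each $j=2,\ldots,k-1$. Then $$i(G_n^{(k)})\le F_k(n+k),$$ and equality holds if and only if $G_n^{(k)}=T_n\langle 1,2,\ldots,k-1\rangle$.
   Context: For a finite simple graph $G$, $i(G)$ is the number of independent sets of $G$ (sets of pairwise non-adjacent vertices), including the empty set. Riordan graph: let $g=\sum_{m\ge0}g_mz^m$ and $f=\sum_{m\ge1}f_mz^m$ be formal power series in $\mathbb{Z}[[z]]$ (so $f$ has zero constant term), and let $[z^m]h$ denote the coefficient of $z^m$ in $h$. The Riordan graph $G_n(g,f)$ is the simple graph with vertex set $\{1,\ldots,n\}$ in which, for $i>j$, the vertices $i$ and $j$ are adjacent if and only if $[z^{i-2}]\,g f^{\,j-1}\equiv 1\pmod 2$. Toeplitz graph: $T_n\langle 1,2,\ldots,k-1\rangle$ is the simple graph with vertex set $\{1,\ldots,n\}$ in which $i,j$ are adjacent if and only if $1\le|i-j|\le k-1$. The equality of graphs in the claim is equality of graphs on the labelled vertex set $\{1,\ldots,n\}$. Generalized Fibonacci numbers: $F_k(1)=\cdots=F_k(k)=1$ and $F_k(m)=F_k(m-1)+F_k(m-k)$ for $m>k$. *)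

theory Defs
  imports
    "HOL-Computational_Algebra.Formal_Power_Series"
    "HOL-Number_Theory.Cong"
    "Graph_Theory.Pair_Digraph"
begin

text \<open>Finite simple graphs are the \<^locale>\<open>pair_graph\<close>s of Graph Theory: finite, loop-free,
  with a symmetric arc relation, so that an undirected edge \<open>ij\<close> is the pair of arcs
  \<open>(i, j)\<close>, \<open>(j, i)\<close>.\<close>

definition independent_sets :: "'a pair_pre_digraph \<Rightarrow> 'a set set" where
  "independent_sets G = {S. S \<subseteq> pverts G \<and> pairwise (\<lambda>u v. (u, v) \<notin> parcs G) S}"

definition num_independent_sets :: "'a pair_pre_digraph \<Rightarrow> nat" where
  "num_independent_sets G = card (independent_sets G)"

text \<open>\<open>riordan_adj g f i j\<close> is only meant for \<open>i > j \<ge> 1\<close>, where the natural number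
  subtractions are exact.\<close>

definition riordan_adj :: "int fps \<Rightarrow> int fps \<Rightarrow> nat \<Rightarrow> nat \<Rightarrow> bool" where
  "riordan_adj g f i j \<longleftrightarrow> [fps_nth (g * f ^ (j - 1)) (i - 2) = 1] (mod 2)"

definition riordan_graph :: "nat \<Rightarrow> int fps \<Rightarrow> int fps \<Rightarrow> nat pair_pre_digraph" where
  "riordan_graph n g f =
     \<lparr> pverts = {1..n},
       parcs = {(i, j). i \<in> {1..n} \<and> j \<in> {1..n} \<and>
                  (i > j \<and> riordan_adj g f i j \<or> j > i \<and> riordan_adj g f j i)} \<rparr>"

text \<open>\<open>toeplitz_graph n D\<close> is \<open>T\<^sub>n\<langle>D\<rangle>\<close>, where \<open>D\<close> is the set of distances at which
  vertices are adjacent.\<close>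

definition toeplitz_graph :: "nat \<Rightarrow> nat set \<Rightarrow> nat pair_pre_digraph" where
  "toeplitz_graph n D =
     \<lparr> pverts = {1..n},
       parcs = {(i, j). i \<in> {1..n} \<and> j \<in> {1..n} \<and> i \<noteq> j \<and> nat \<bar>int i - int j\<bar> \<in> D} \<rparr>"

text \<open>The values for \<open>k = 0\<close> or \<open>m = 0\<close> are conventions that make the function total.\<close>

function gen_fib :: "nat \<Rightarrow> nat \<Rightarrow> nat" where
  "gen_fib k m = (if k = 0 \<or> m \<le> k then 1 else gen_fib k (m - 1) + gen_fib k (m - k))"
  by auto
termination by (relation "measure snd") auto

declare gen_fib.simps [simp del]

lemma gen_fib_init: "1 \<le> m \<Longrightarrow> m \<le> k \<Longrightarrow> gen_fib k m = 1"
  by (simp add: gen_fib.simps)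

lemma gen_fib_rec: "1 \<le> k \<Longrightarrow> m > k \<Longrightarrow> gen_fib k m = gen_fib k (m - 1) + gen_fib k (m - k)"
  by (subst gen_fib.simps) simp

lemma pair_graph_riordan_graph: "pair_graph (riordan_graph n g f)"
proof
  show "finite (parcs (riordan_graph n g f))"
    by (rule finite_subset[of _ "{1..n} \<times> {1..n}"]) (auto simp: riordan_graph_def)
qed (auto simp: riordan_graph_def symmetric_def sym_def)

lemma pair_graph_toeplitz_graph: "pair_graph (toeplitz_graph n D)"
proof
  show "finite (parcs (toeplitz_graph n D))"
    by (rule finite_subset[of _ "{1..n} \<times> {1..n}"]) (auto simp: toeplitz_graph_def)
qed (auto simp: toeplitz_graph_def symmetric_def sym_def abs_minus_commute)

lemma parcs_toeplitz_graph_interval: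
  "(i, j) \<in> parcs (toeplitz_graph n {1..k - 1}) \<longleftrightarrow>
     i \<in> {1..n} \<and> j \<in> {1..n} \<and> 1 \<le> \<bar>int i - int j\<bar> \<and> \<bar>int i - int j\<bar> \<le> int k - 1"
  by (auto simp: toeplitz_graph_def)

end

theory Submission
  imports Defs
begin

text \<open>Modulo 2 and \<open>z ^ (k - 1)\<close>, the series \<open>f / z\<close> is \<open>1\<close> and \<open>g\<close> is \<open>1 / (1 - z)\<close>.
  Hence the Toeplitz graph is a subgraph of the Riordan graph, and adding edges to a graph on the same
  vertices strictly decreases the number of independent sets. For the Toeplitz graph, splitting
  the independent sets by whether they contain the last vertex gives the generalized Fibonacci
  recurrence.\<close>

lemma independent_sets_antimono:
  assumes "pverts G = pverts H" "parcs G \<subseteq> parcs H"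
  shows "independent_sets H \<subseteq> independent_sets G"
  using assms by (fastforce simp: independent_sets_def pairwise_def)

lemma finite_independent_sets: "finite (pverts G) \<Longrightarrow> finite (independent_sets G)"
  by (simp add: independent_sets_def)

text \<open>The independent sets of size two are exactly the non-edges, so a graph is recovered from
  its vertex set and its family of independent sets. This is what settles the equality case.\<close>

lemma parcs_eq_iff_independent_sets:
  assumes "pair_graph G" "pair_graph H" "pverts G = pverts H"
  shows "(u, v) \<in> parcs G \<longleftrightarrow>
    u \<in> pverts H \<and> v \<in> pverts H \<and> u \<noteq> v \<and> {u, v} \<notin> independent_sets G"
proof -
  interpret G: pair_graph G by fact
  \<comment> \<open>Independence of \<open>{u, v}\<close> excludes both arcs; symmetry lets a single
    arc violate it.\<close>
  have sym: "(u, v) \<in> parcs G \<longleftrightarrow> (v, u) \<in> parcs G"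
    by (rule G.arcs_symmetric[THEN iffI]) (auto intro: G.arcs_symmetric)
  have "u \<in> pverts G \<and> v \<in> pverts G \<and> u \<noteq> v" if "(u, v) \<in> parcs G"
    using that G.wellformed G.no_loops by fastforce
  then show ?thesis
    using sym by (auto simp: independent_sets_def pairwise_insert assms(3))
qed

text \<open>The families are nested and finite, so equal cardinality makes them equal, and the
  family determines the arcs.\<close>

lemma num_independent_sets_supergraph:
  assumes "pair_graph G" "pair_graph H" "pverts G = pverts H" "parcs G \<subseteq> parcs H"
  shows "num_independent_sets H \<le> num_independent_sets G"
    and "num_independent_sets H = num_independent_sets G \<longleftrightarrow> H = G"
proof -
  interpret G: pair_graph G by fact
  have fin: "finite (independent_sets G)"
    by (intro finite_independent_sets G.pair_finite_verts)
  have sub: "independent_sets H \<subseteq> independent_sets G"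
    using assms(3,4) by (rule independent_sets_antimono)
  show "num_independent_sets H \<le> num_independent_sets G"
    unfolding num_independent_sets_def by (intro card_mono fin sub)
  have "H = G" if "num_independent_sets H = num_independent_sets G"
  proof -
    have "independent_sets H = independent_sets G"
      using that fin sub unfolding num_independent_sets_def by (intro card_subset_eq)
    then have "(u, v) \<in> parcs H \<longleftrightarrow> (u, v) \<in> parcs G" for u v
      using assms(1-3) by (simp add: parcs_eq_iff_independent_sets[where H = H]
        parcs_eq_iff_independent_sets[where G = H and H = G])
    then have "parcs H = parcs G" by auto
    then show ?thesis using assms(3) by simp
  qed
  then show "num_independent_sets H = num_independent_sets G \<longleftrightarrow> H = G"
    by auto
qed

text \<open>Adjacency becomes a gap condition on ordered pairs, free of arcs and absolute values;
  the recursion below works only with this form.\<close>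

lemma independent_sets_toeplitz_interval:
  "independent_sets (toeplitz_graph n {1..k - 1}) =
    {S. S \<subseteq> {1..n} \<and> (\<forall>u\<in>S. \<forall>v\<in>S. u < v \<longrightarrow> u + k \<le> v)}"
proof -
  have "pairwise (\<lambda>u v. (u, v) \<notin> parcs (toeplitz_graph n {1..k - 1})) S \<longleftrightarrow>
      (\<forall>u\<in>S. \<forall>v\<in>S. u < v \<longrightarrow> u + k \<le> v)" (is "?P \<longleftrightarrow> ?Q") if S: "S \<subseteq> {1..n}" for S
  proof
    assume P: ?P
    show ?Q
    proof (intro ballI impI)
      fix u v assume uv: "u \<in> S" "v \<in> S" "u < v"
      with P have "(u, v) \<notin> parcs (toeplitz_graph n {1..k - 1})"
        by (auto simp: pairwise_def)
      with uv S show "u + k \<le> v"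
        unfolding parcs_toeplitz_graph_interval by auto
    qed
  next
    assume Q: ?Q
    show ?P
    proof (intro pairwiseI)
      fix u v assume uv: "u \<in> S" "v \<in> S" "u \<noteq> v"
      then have "u + k \<le> v \<or> v + k \<le> u"
        using Q by (meson linorder_neqE_nat)
      then show "(u, v) \<notin> parcs (toeplitz_graph n {1..k - 1})"
        unfolding parcs_toeplitz_graph_interval by auto
    qed
  qed
  then show ?thesis
    by (auto simp: independent_sets_def toeplitz_graph_def)
qed

text \<open>The gap condition pushes all other elements of a set containing \<open>Suc n\<close>
  down to at most \<open>Suc n - k\<close>. If \<open>Suc n \<le> k\<close>, the subtraction gives
  0, \<open>I 0\<close> holds only the empty set, and the second family is just
  \<open>{{Suc n}}\<close>.\<close>

lemma independent_sets_toeplitz_Suc: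
  fixes n k :: nat
  assumes "k \<ge> 1"
  defines "I m \<equiv> independent_sets (toeplitz_graph m {1..k - 1})"
  shows "I (Suc n) = I n \<union> insert (Suc n) ` I (Suc n - k)"
proof (intro set_eqI iffI)
  fix S assume S: "S \<in> I (Suc n)"
  show "S \<in> I n \<union> insert (Suc n) ` I (Suc n - k)"
  proof (cases "Suc n \<in> S")
    case True
    have "x \<le> Suc n - k" if "x \<in> S" "x \<noteq> Suc n" for x
    proof -
      have "x < Suc n"
        using S that unfolding I_def independent_sets_toeplitz_interval by force
      then have "x + k \<le> Suc n"
        using S True that unfolding I_def independent_sets_toeplitz_interval by blast
      then show ?thesis by simp
    qed
    then have "S - {Suc n} \<in> I (Suc n - k)"
      using S unfolding I_def independent_sets_toeplitz_interval by fastforce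
    moreover have "S = insert (Suc n) (S - {Suc n})"
      using True by auto
    ultimately show ?thesis by blast
  next
    case False
    then show ?thesis
      using S unfolding I_def independent_sets_toeplitz_interval by (fastforce simp: le_Suc_eq)
  qed
next
  fix S assume "S \<in> I n \<union> insert (Suc n) ` I (Suc n - k)"
  then show "S \<in> I (Suc n)"
    using assms(1) unfolding I_def independent_sets_toeplitz_interval by fastforce
qed

lemma num_independent_sets_toeplitz:
  assumes "k \<ge> 1"
  shows "num_independent_sets (toeplitz_graph n {1..k - 1}) = gen_fib k (n + k)"
proof (induction n rule: less_induct)
  case (less n)
  define I where "I m = independent_sets (toeplitz_graph m {1..k - 1})" for m
  have fin: "finite (I m)" for m
    unfolding I_def by (rule finite_independent_sets) (simp add: toeplitz_graph_def)
  \<comment> \<open>Freshness of \<open>n\<close> yields both the injectivity of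
    \<open>insert n\<close> and the disjointness of the two families.\<close>
  have notin: "m' \<notin> S" if "S \<in> I m" "m < m'" for S m m'
    using that unfolding I_def independent_sets_toeplitz_interval by auto
  show ?case
  proof (cases n)
    case 0
    have "independent_sets (toeplitz_graph 0 {1..k - 1}) = {{}}"
      unfolding independent_sets_toeplitz_interval by auto
    with 0 assms show ?thesis
      by (simp add: num_independent_sets_def gen_fib_init)
  next
    case (Suc m)
    have "inj_on (insert n) (I (n - k))"
    proof (rule inj_onI)
      fix S T assume "S \<in> I (n - k)" "T \<in> I (n - k)" "insert n S = insert n T"
      moreover from this have "n \<notin> S" "n \<notin> T"
        using notin assms Suc by auto
      ultimately show "S = T" by (meson insert_ident)
    qed
    moreover have "I m \<inter> insert n ` I (n - k) = {}"
      using notin[of _ m n] Suc by blast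
    moreover have "I n = I m \<union> insert n ` I (n - k)"
      unfolding I_def Suc by (rule independent_sets_toeplitz_Suc[OF assms])
    ultimately have "card (I n) = card (I m) + card (I (n - k))"
      by (simp add: card_Un_disjoint fin card_image)
    also have "\<dots> = gen_fib k (m + k) + gen_fib k (n - k + k)"
      using less.IH[of m] less.IH[of "n - k"] Suc assms
      by (simp add: num_independent_sets_def I_def)
    \<comment> \<open>For \<open>n < k\<close> the left argument is \<open>k\<close> instead of
      \<open>n\<close>, but both lie in the initial segment where the value is 1.\<close>
    also have "gen_fib k (n - k + k) = gen_fib k n"
      using Suc assms by (cases "k \<le> n") (simp_all add: gen_fib_init)
    also have "gen_fib k (m + k) + gen_fib k n = gen_fib k (n + k)"
      using Suc assms by (subst (3) gen_fib_rec) simp_all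
    finally show ?thesis
      by (simp add: num_independent_sets_def I_def)
  qed
qed

text \<open>Coefficient \<open>e\<close> of the product involves only the coefficients of
  \<open>a\<close> up to \<open>e\<close>, and modulo \<open>q\<close> these are those of the series
  1. Hence only the term \<open>i = 0\<close> of the Cauchy product survives.\<close>

lemma fps_mult_nth_cong_one:
  fixes a b :: "int fps"
  assumes "[fps_nth a 0 = 1] (mod q)" "\<And>i. 1 \<le> i \<Longrightarrow> i \<le> e \<Longrightarrow> [fps_nth a i = 0] (mod q)"
  shows "[fps_nth (a * b) e = fps_nth b e] (mod q)"
proof -
  have "[(\<Sum>i=0..e. fps_nth a i * fps_nth b (e - i)) =
      (\<Sum>i=0..e. (if i = 0 then 1 else 0) * fps_nth b (e - i))] (mod q)"
    using assms by (intro cong_sum cong_mult) auto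
  also have "(\<Sum>i=0..e. (if i = 0 then 1 else 0) * fps_nth b (e - i)) = fps_nth b e"
    by (simp add: if_distrib[of "\<lambda>x. x * _"] cong: if_cong)
  finally show ?thesis
    by (simp add: fps_mult_nth)
qed

lemma fps_power_mult_nth_cong_one:
  fixes a b :: "int fps"
  assumes "[fps_nth a 0 = 1] (mod q)" "\<And>i. 1 \<le> i \<Longrightarrow> i \<le> e \<Longrightarrow> [fps_nth a i = 0] (mod q)"
  shows "[fps_nth (a ^ m * b) e = fps_nth b e] (mod q)"
proof (induction m)
  case (Suc m)
  have "[fps_nth (a * (a ^ m * b)) e = fps_nth (a ^ m * b) e] (mod q)"
    using assms by (rule fps_mult_nth_cong_one)
  with Suc show ?case
    by (auto simp: mult.assoc intro: cong_trans)
qed simp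

text \<open>With f = z h, the factor z^(j-1) of f^(j-1) shifts the index \<open>i - 2\<close> to
  \<open>i - j - 1\<close>. This is at most \<open>k - 2\<close>, within the range where h is 1 and
  all coefficients of g are 1 modulo 2.\<close>

lemma riordan_adj_near:
  assumes "fps_nth f 0 = 0" "\<forall>i\<in>{0..k - 2}. [fps_nth g i = 1] (mod 2)"
    and "[fps_nth f 1 = 1] (mod 2)" "\<forall>j\<in>{2..k - 1}. [fps_nth f j = 0] (mod 2)"
    and "j \<ge> 1" "j < i" "i - j \<le> k - 1"
  shows "riordan_adj g f i j"
proof -
  define h where "h = fps_shift 1 f"
  have f: "f = fps_X * h"
    using assms(1) by (intro fps_ext) (simp add: h_def)
  have eq: "g * f ^ (j - 1) = fps_X ^ (j - 1) * (h ^ (j - 1) * g)"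
    by (simp add: f power_mult_distrib mult_ac)
  have "fps_nth (g * f ^ (j - 1)) (i - 2) = fps_nth (h ^ (j - 1) * g) (i - j - 1)"
    using assms(5,6) unfolding eq fps_X_power_mult_nth by (auto simp: numeral_2_eq_2)
  also have "[fps_nth (h ^ (j - 1) * g) (i - j - 1) = fps_nth g (i - j - 1)] (mod 2)"
    \<comment> \<open>Coefficients 1 to \<open>k - 2\<close> of \<open>h\<close> are coefficients 2
      to \<open>k - 1\<close> of \<open>f\<close>, hence even; the constant term of \<open>h\<close>
      is the odd coefficient 1 of \<open>f\<close>.\<close>
    using assms(3,4,7) by (intro fps_power_mult_nth_cong_one) (auto simp: h_def)
  also have "[fps_nth g (i - j - 1) = 1] (mod 2)"
    using assms(2,7) by auto
  finally show ?thesis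
    by (simp add: riordan_adj_def)
qed

theorem theorem2p4:
  fixes k n :: nat and g f :: "int fps"
  assumes "k \<ge> 3" and "n \<ge> 1"
    and "fps_nth f 0 = 0"
    and "\<forall>i\<in>{0..k - 2}. [fps_nth g i = 1] (mod 2)"
    and "[fps_nth f 1 = 1] (mod 2)"
    and "\<forall>j\<in>{2..k - 1}. [fps_nth f j = 0] (mod 2)"
  shows "num_independent_sets (riordan_graph n g f) \<le> gen_fib k (n + k) \<and>
         (num_independent_sets (riordan_graph n g f) = gen_fib k (n + k) \<longleftrightarrow>
          riordan_graph n g f = toeplitz_graph n {1..k - 1})"
proof -
  have num: "gen_fib k (n + k) = num_independent_sets (toeplitz_graph n {1..k - 1})"
    by (rule num_independent_sets_toeplitz[symmetric]) (use assms(1) in simp)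
  have verts: "pverts (toeplitz_graph n {1..k - 1}) = pverts (riordan_graph n g f)"
    by (simp add: toeplitz_graph_def riordan_graph_def)
  have arcs: "parcs (toeplitz_graph n {1..k - 1}) \<subseteq> parcs (riordan_graph n g f)"
  proof (rule subrelI)
    fix i j assume ij: "(i, j) \<in> parcs (toeplitz_graph n {1..k - 1})"
    have near: "riordan_adj g f i j" if "1 \<le> j" "j < i" "i - j \<le> k - 1" for i j
      using assms(3-6) that by (rule riordan_adj_near)
    \<comment> \<open>An arc may run in either direction, while \<open>riordan_adj\<close> expects
      the larger vertex first, so the integer distance is split into two natural
      differences.\<close>
    have "i < j \<and> j - i \<le> k - 1 \<or> j < i \<and> i - j \<le> k - 1"
      using ij unfolding parcs_toeplitz_graph_interval by linarith
    then show "(i, j) \<in> parcs (riordan_graph n g f)"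
      using ij near unfolding parcs_toeplitz_graph_interval by (auto simp: riordan_graph_def)
  qed
  show ?thesis
    unfolding num
    using num_independent_sets_supergraph[OF pair_graph_toeplitz_graph pair_graph_riordan_graph
        verts arcs]
    by blast
qed

end
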